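(* Let $0<\alpha<1$, let $\beta_2\in[-1,1]$, and let $Z_1,Z_2$ be independent standard normal random variables. The function $\mathbf 1\{G_0(Z_1,Z_2)\le x\}$ has Hermite rank $m=m(x)=1$ for all $x\in(-\infty,\infty)$, with coefficients: (a) for $x>0$, $$J_{1,0}(x,\beta_2)=\frac1\pi\int_{\gamma_0}^{\pi/2} e^{-x^{\frac{\alpha}{\alpha-1}}a(\gamma)}\,\Phi^{-1}\!\left(\tfrac1\pi\left(\gamma+\tfrac\pi2\right)\right)d\gamma-(\phi\circ\Phi^{-1})\!\left(\tfrac1\pi\left(\gamma_0+\tfrac\pi2\right)\right),$$ $$J_{0,1}(x,\beta_2)=\frac1\pi\int_{\gamma_0}^{\pi/2}(\phi\circ\Phi^{-1})\!\left(1-e^{-x^{\frac{\alpha}{\alpha-1}}a(\gamma)}\right)d\gamma ;$$ (b) for $x=0$, $$J_{1,0}(0,\beta_2)=-(\phi\circ\Phi^{-1})\!\left(\tfrac1\pi\left(\gamma_0+\tfrac\pi2\right)\right),\qquad J_{0,1}(0,\beta_2)=0 ;$$ (c) for $x<0$, $$J_{1,0}(x,\beta_2)=J_{1,0}(-x,-\beta_2),\qquad J_{0,1}(x,\beta_2)=-J_{0,1}(-x,-\beta_2),$$ where the right-hand sides are computed from the formulas in (a) with $x$ replaced by $-x$ and $\beta_2$ replaced by $-\beta_2$ (also in $\gamma_0$ and $a$).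
   Context: $\phi$ and $\Phi$ denote the density and cumulative distribution function of the standard normal distribution; $\phi\circ\Phi^{-1}$ is extended by continuity to $[0,1]$, i.e. $(\phi\circ\Phi^{-1})(0)=(\phi\circ\Phi^{-1})(1)=0$. For $z_1,z_2\in\mathbb{R}$ put $$\gamma(z_1)=\pi\Phi(z_1)-\tfrac{\pi}{2},\qquad W(z_2)=-\log(1-\Phi(z_2)).$$ For $0<\alpha<2$, $\alpha\ne1$, let $K(\alpha)=\alpha-1+\operatorname{sign}(1-\alpha)$ and $$\gamma_0=\gamma_0(\beta_2)=-\beta_2\frac{\pi K(\alpha)}{2\alpha},$$ $$G_0(z_1,z_2)=\frac{\sin(\alpha(\gamma(z_1)-\gamma_0))}{(\cos\gamma(z_1))^{1/\alpha}}\left(\frac{\cos(\gamma(z_1)-\alpha(\gamma(z_1)-\gamma_0))}{W(z_2)}\right)^{(1-\alpha)/\alpha},$$ $$a(\gamma)=\left(\frac{\sin\alpha(\gamma-\gamma_0)}{\cos\gamma}\right)^{\frac{\alpha}{1-\alpha}}\frac{\cos(\gamma-\alpha(\gamma-\gamma_0))}{\cos\gamma}.$$ The random variable $G_0(Z_1,Z_2)$ is $\alpha$-stable with asymmetry parameter $\beta_2$, unit scale and zero location, in the parametrization where for $\alpha\ne1$ the log-characteristic function is $-|z|^\alpha\exp\{-i\beta_2\operatorname{sign}(z)\frac{\pi}{2}K(\alpha)\}$. The Hermite polynomials are $H_m(u)=(-1)^m\phi(u)^{-1}\frac{d^m}{du^m}\phi(u)$, so $H_0=1$, $H_1(u)=u$.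 The Hermite coefficients are $$J_{m_1,m_2}(x,\beta_2)=\mathrm{E}\left[\mathbf 1\{G_0(Z_1,Z_2)\le x\}\,H_{m_1}(Z_1)H_{m_2}(Z_2)\right],\qquad m_1,m_2\ge0,$$ and the Hermite rank is $m(x)=\min\{m_1+m_2\ge1: J_{m_1,m_2}(x,\beta_2)\ne0\}$.
   Formalization: The claim that the Hermite rank is 1 excludes β₂ = 1 with x ≤ 0 and β₂ = −1 with x ≥ 0, where the indicator is constant, all coefficients with m₁+m₂ ≥ 1 vanish and the rank claim fails; formulas (a)–(c) keep all β₂ in [−1,1]. *)

theory Defs
  imports "HOL-Probability.Probability"
begin

definition Phi :: "real \<Rightarrow> real" where
  "Phi = cdf std_normal_distribution"

text \<open>Only meaningful on the open unit interval, the range of the injective function \<^const>\<open>Phi\<close>.\<close>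

definition Phi_inv :: "real \<Rightarrow> real" where
  "Phi_inv = inv Phi"

text \<open>The composition of the density with the quantile function, extended continuously by 0
  to the endpoints of the unit interval (and by 0 outside it).\<close>

definition phi_Phi_inv :: "real \<Rightarrow> real" where
  "phi_Phi_inv p = (if 0 < p \<and> p < 1 then std_normal_density (Phi_inv p) else 0)"

definition gam :: "real \<Rightarrow> real" where
  "gam z = pi * Phi z - pi / 2"

definition W_fun :: "real \<Rightarrow> real" where
  "W_fun z = - ln (1 - Phi z)"

definition K_fun :: "real \<Rightarrow> real" where
  "K_fun \<alpha> = \<alpha> - 1 + sgn (1 - \<alpha>)"

definition gamma0 :: "real \<Rightarrow> real \<Rightarrow> real" where
  "gamma0 \<alpha> \<beta> = - \<beta> * (pi * K_fun \<alpha> / (2 * \<alpha>))"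

definition G0 :: "real \<Rightarrow> real \<Rightarrow> real \<Rightarrow> real \<Rightarrow> real" where
  "G0 \<alpha> \<beta> z1 z2 =
     sin (\<alpha> * (gam z1 - gamma0 \<alpha> \<beta>)) / cos (gam z1) powr (1 / \<alpha>)
     * (cos (gam z1 - \<alpha> * (gam z1 - gamma0 \<alpha> \<beta>)) / W_fun z2) powr ((1 - \<alpha>) / \<alpha>)"

definition a_fun :: "real \<Rightarrow> real \<Rightarrow> real \<Rightarrow> real" where
  "a_fun \<alpha> \<beta> \<gamma> =
     (sin (\<alpha> * (\<gamma> - gamma0 \<alpha> \<beta>)) / cos \<gamma>) powr (\<alpha> / (1 - \<alpha>))
     * (cos (\<gamma> - \<alpha> * (\<gamma> - gamma0 \<alpha> \<beta>)) / cos \<gamma>)"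

definition Hermite :: "nat \<Rightarrow> real \<Rightarrow> real" where
  "Hermite m u = (-1) ^ m * inverse (std_normal_density u) * (deriv ^^ m) std_normal_density u"

definition Hermite_coeff :: "'w measure \<Rightarrow> ('w \<Rightarrow> real) \<Rightarrow> ('w \<Rightarrow> real) \<Rightarrow>
    real \<Rightarrow> nat \<Rightarrow> nat \<Rightarrow> real \<Rightarrow> real \<Rightarrow> real" where
  "Hermite_coeff M Z1 Z2 \<alpha> m1 m2 x \<beta> =
     (\<integral>\<omega>. indicator {..x} (G0 \<alpha> \<beta> (Z1 \<omega>) (Z2 \<omega>)) * Hermite m1 (Z1 \<omega>) * Hermite m2 (Z2 \<omega>) \<partial>M)"

text \<open>The minimum of the empty set is read as \<open>\<infinity>\<close>: this is the rank if the indicator is almost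
  surely constant.\<close>

definition Hermite_rank :: "'w measure \<Rightarrow> ('w \<Rightarrow> real) \<Rightarrow> ('w \<Rightarrow> real) \<Rightarrow>
    real \<Rightarrow> real \<Rightarrow> real \<Rightarrow> enat" where
  "Hermite_rank M Z1 Z2 \<alpha> x \<beta> =
     Inf {enat (m1 + m2) | m1 m2. m1 + m2 \<ge> 1 \<and> Hermite_coeff M Z1 Z2 \<alpha> m1 m2 x \<beta> \<noteq> 0}"

text \<open>The closed formulas for the coefficients are used for positive \<open>x\<close> only; the integrals are
  over the open interval, where \<^const>\<open>a_fun\<close> is positive.\<close>

definition J10_formula :: "real \<Rightarrow> real \<Rightarrow> real \<Rightarrow> real" where
  "J10_formula \<alpha> x \<beta> =
     1 / pi * (LBINT \<gamma>=ereal (gamma0 \<alpha> \<beta>)..ereal (pi / 2).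
       exp (- (x powr (\<alpha> / (\<alpha> - 1)) * a_fun \<alpha> \<beta> \<gamma>)) * Phi_inv (1 / pi * (\<gamma> + pi / 2)))
     - phi_Phi_inv (1 / pi * (gamma0 \<alpha> \<beta> + pi / 2))"

definition J01_formula :: "real \<Rightarrow> real \<Rightarrow> real \<Rightarrow> real" where
  "J01_formula \<alpha> x \<beta> =
     1 / pi * (LBINT \<gamma>=ereal (gamma0 \<alpha> \<beta>)..ereal (pi / 2).
       phi_Phi_inv (1 - exp (- (x powr (\<alpha> / (\<alpha> - 1)) * a_fun \<alpha> \<beta> \<gamma>))))"

end

theory Submission
  imports Defs
begin

text \<open>For \<open>0 < \<alpha> < 1\<close> the constant \<^const>\<open>K_fun\<close> equals \<open>\<alpha>\<close>, so \<open>\<gamma>\<^sub>0 = -\<beta> \<pi>/2\<close> lies in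
  \<open>[-\<pi>/2, \<pi>/2]\<close>, and the angle \<open>\<gamma> = gam z\<^sub>1\<close> and the level \<open>W z\<^sub>2\<close> play separate roles in \<^const>\<open>G0\<close>:
  the angle alone decides the sign, and once \<open>\<gamma> > \<gamma>\<^sub>0\<close> the value is positive and decreasing in \<open>z\<^sub>2\<close>.
  Hence for \<open>x > 0\<close> the sublevel set consists of the half plane \<open>\<gamma> \<le> \<gamma>\<^sub>0\<close> and of those points with
  \<open>\<gamma> > \<gamma>\<^sub>0\<close> for which \<open>\<Phi>(z\<^sub>2)\<close> is at least the threshold \<open>1 - exp (- x powr (\<alpha>/(\<alpha>-1)) * a(\<gamma>))\<close>
  (\<open>G0_le_pos_iff\<close>).

  By independence a coefficient is an iterated integral, with \<open>z\<^sub>2\<close> innermost. The section of the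
  sublevel set over a given \<open>z\<^sub>1\<close> is empty, everything, or a half line. The inner integral is then
  the probability of that half line for \<open>J\<^sub>1\<^sub>,\<^sub>0\<close>, and for \<open>J\<^sub>0\<^sub>,\<^sub>1\<close> it is the mean over the half line,
  which is a value of the density because \<open>-\<phi>\<close> is an antiderivative of \<open>z \<phi>(z)\<close>
  (\<open>std_normal_upper_mean\<close>). The outer integral becomes an integral over the angle
  because \<open>gam Z\<^sub>1\<close> is uniform on \<open>[-\<pi>/2, \<pi>/2]\<close> (\<open>expectation_above_angle\<close>). The half plane
  \<open>\<gamma> \<le> \<gamma>\<^sub>0\<close> contributes the boundary term of \<open>J\<^sub>1\<^sub>,\<^sub>0\<close>, and nothing to \<open>J\<^sub>0\<^sub>,\<^sub>1\<close>.

  For \<open>x < 0\<close> the symmetry \<open>G0 \<alpha> (-\<beta>) (-z\<^sub>1) z\<^sub>2 = - G0 \<alpha> \<beta> z\<^sub>1 z\<^sub>2\<close> reduces everything to \<open>-x\<close> and \<open>-\<beta>\<close>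
  (\<open>Hermite_coeff_reflect\<close>). Finally, \<open>J\<^sub>0\<^sub>,\<^sub>1\<close> is an integral of a positive function over \<open>(\<gamma>\<^sub>0, \<pi>/2)\<close>
  if \<open>x > 0\<close>, and \<open>J\<^sub>1\<^sub>,\<^sub>0\<close> is minus a value of the density if \<open>x = 0\<close>, so one of them
  is nonzero unless the distribution is one-sided with \<open>x\<close> outside its support or at its endpoint
  \<open>0\<close>, and these are exactly the exclusions in the statement about the rank.\<close>

section \<open>The standard normal distribution function and its quantile function\<close>

abbreviation "std_normal \<equiv> std_normal_distribution"

interpretation std_normal: real_distribution std_normal_distribution
  by (rule real_dist_normal_dist)

lemma Phi_eq_measure: "Phi z = measure std_normal {..z}"
  by (simp add: Phi_def cdf_def)

lemma distributed_std_normal_id: "distributed std_normal lborel (\<lambda>z. z) std_normal_density"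
  by (auto simp: distributed_def distr_id2)

lemma measure_std_normal_singleton: "measure std_normal {z} = 0"
proof -
  have "emeasure std_normal {z} = 0"
    by (simp add: emeasure_density nn_integral_0_iff_AE)
  then show ?thesis by (simp add: measure_def)
qed

lemma isCont_Phi: "isCont Phi z"
  unfolding Phi_def by (simp add: std_normal.isCont_cdf measure_std_normal_singleton)

lemma borel_measurable_Phi [measurable]: "Phi \<in> borel_measurable borel"
  by (intro borel_measurable_continuous_onI continuous_at_imp_continuous_on ballI isCont_Phi)

lemma Phi_strict_mono: "strict_mono Phi"
proof (rule strict_monoI)
  fix x y :: real assume xy: "x < y"
  have "emeasure std_normal {x<..y} \<noteq> 0"
  proof
    assume "emeasure std_normal {x<..y} = 0"
    then have "AE z in lborel. z \<notin> {x<..y}"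
      by (simp add: emeasure_density nn_integral_0_iff_AE)
         (erule eventually_mono, use normal_density_pos[of 1 0] in \<open>auto simp: indicator_def less_le split: if_splits\<close>)
    then have "emeasure lborel {x<..y} = 0"
      by (subst (asm) AE_iff_measurable[where N = "{x<..y}"]) auto
    then show False using xy by simp
  qed
  then have "0 < measure std_normal {x<..y}"
    using std_normal.emeasure_eq_measure[of "{x<..y}"] by (simp add: zero_less_measure_iff)
  then show "Phi x < Phi y"
    using std_normal.cdf_diff_eq[OF xy] by (simp add: Phi_def)
qed

lemma Phi_less_iff: "Phi x < Phi y \<longleftrightarrow> x < y"
  by (rule strict_mono_less[OF Phi_strict_mono])

lemma Phi_le_iff: "Phi x \<le> Phi y \<longleftrightarrow> x \<le> y"
  by (rule strict_mono_less_eq[OF Phi_strict_mono])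

lemma inj_Phi: "inj Phi"
  by (rule strict_mono_imp_inj_on[OF Phi_strict_mono])

lemma Phi_pos: "0 < Phi z"
  using Phi_less_iff[of "z - 1" z] std_normal.cdf_nonneg[of "z - 1"] by (simp add: Phi_def)

lemma Phi_less_1: "Phi z < 1"
  using Phi_less_iff[of z "z + 1"] std_normal.cdf_bounded_prob[of "z + 1"] by (simp add: Phi_def)

lemma Phi_Phi_inv:
  assumes "0 < p" "p < 1"
  shows "Phi (Phi_inv p) = p"
proof -
  obtain l where l: "Phi l < p"
    using order_tendstoD(2)[OF std_normal.cdf_lim_at_bot \<open>0 < p\<close>]
    by (auto simp: Phi_def eventually_at_bot_linorder)
  obtain u where u: "p < Phi u"
    using order_tendstoD(1)[OF std_normal.cdf_lim_at_top_prob \<open>p < 1\<close>]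
    by (auto simp: Phi_def eventually_at_top_linorder)
  have "l \<le> u" using l u Phi_le_iff[of l u] by linarith
  then obtain z where "Phi z = p"
    using IVT[of Phi l p u] l u isCont_Phi by auto
  then have "p \<in> range Phi" by blast
  then show ?thesis
    unfolding Phi_inv_def by (rule f_inv_into_f)
qed

lemma Phi_inv_Phi: "Phi_inv (Phi z) = z"
  unfolding Phi_inv_def by (rule inv_f_f[OF inj_Phi])

lemma Phi_inv_le_iff: "0 < p \<Longrightarrow> p < 1 \<Longrightarrow> Phi_inv p \<le> z \<longleftrightarrow> p \<le> Phi z"
  using Phi_le_iff[of "Phi_inv p" z] by (simp add: Phi_Phi_inv)

text \<open>The inverse \<^const>\<open>Phi_inv\<close> is monotone on the unit interval; outside it, the choice operator
  behind \<^const>\<open>inv\<close> returns one fixed real number, so measurability holds on the whole line.\<close>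

lemma borel_measurable_Phi_inv [measurable]: "Phi_inv \<in> borel_measurable borel"
proof (rule borel_measurableI_le)
  fix y
  define c :: real where "c = (SOME z. False)"
  have outside: "Phi_inv p = c" if "\<not> (0 < p \<and> p < 1)" for p
  proof -
    have "Phi z \<noteq> p" for z using that Phi_pos[of z] Phi_less_1[of z] by auto
    then show ?thesis by (simp add: Phi_inv_def inv_into_def c_def)
  qed
  have "{p \<in> space borel. Phi_inv p \<le> y} =
      {0<..<1} \<inter> {..Phi y} \<union> (if c \<le> y then - {0<..<1} else {})"
  proof (rule set_eqI)
    fix p
    show "p \<in> {p \<in> space borel. Phi_inv p \<le> y} \<longleftrightarrow>
        p \<in> {0<..<1} \<inter> {..Phi y} \<union> (if c \<le> y then - {0<..<1} else {})"
      using outside[of p] Phi_inv_le_iff[of p y] by (cases "0 < p \<and> p < 1") auto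
  qed
  then show "{p \<in> space borel. Phi_inv p \<le> y} \<in> sets borel" by simp
qed

lemma borel_measurable_phi_Phi_inv [measurable]: "phi_Phi_inv \<in> borel_measurable borel"
  unfolding phi_Phi_inv_def[abs_def] by measurable

lemma phi_Phi_inv_pos: "0 < p \<Longrightarrow> p < 1 \<Longrightarrow> 0 < phi_Phi_inv p"
  by (simp add: phi_Phi_inv_def normal_density_pos)

lemma measure_std_normal_atLeast: "measure std_normal {z..} = 1 - Phi z"
proof -
  have "measure std_normal {z..} = measure std_normal ({z} \<union> {z<..})"
    by (intro arg_cong[where f = "measure std_normal"]) auto
  also have "\<dots> = measure std_normal {z<..}"
    by (subst std_normal.finite_measure_Union) (auto simp: measure_std_normal_singleton)
  also have "{z<..} = space std_normal - {..z}" by auto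
  also have "measure std_normal (space std_normal - {..z}) = 1 - measure std_normal {..z}"
    by (rule std_normal.prob_compl) simp
  finally show ?thesis by (simp add: Phi_eq_measure)
qed

lemma Phi_minus: "Phi (- z) = 1 - Phi z"
proof -
  have "distributed std_normal lborel (\<lambda>z. 0 + (-1) * z) (normal_density (0 + (-1) * 0) (\<bar>-1\<bar> * 1))"
    by (rule std_normal.normal_density_affine[OF distributed_std_normal_id]) auto
  then have "distributed std_normal lborel uminus std_normal_density" by simp
  then have law: "distr std_normal lborel uminus = std_normal"
    by (simp add: distributed_def)
  have "measure std_normal {..- z} = measure (distr std_normal lborel uminus) {..- z}"
    by (simp add: law)
  also have "\<dots> = measure std_normal (uminus -` {..- z} \<inter> space std_normal)"
    by (rule measure_distr) auto
  also have "uminus -` {..- z} \<inter> space std_normal = {z..}" by auto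
  finally show ?thesis by (simp add: Phi_eq_measure[of "- z"] measure_std_normal_atLeast)
qed

lemma prob_Phi_ge:
  assumes "0 < p" "p < 1"
  shows "measure std_normal {z. p \<le> Phi z} = 1 - p"
proof -
  have "{z. p \<le> Phi z} = {Phi_inv p..}"
    using assms by (auto simp: Phi_inv_le_iff)
  then have "measure std_normal {z. p \<le> Phi z} = measure std_normal {Phi_inv p..}"
    by (rule arg_cong)
  also have "\<dots> = 1 - p"
    unfolding measure_std_normal_atLeast Phi_Phi_inv[OF assms] by (rule refl)
  finally show ?thesis .
qed

lemma integrable_std_normal_id: "integrable std_normal (\<lambda>z. z)"
proof -
  have "integrable lborel (\<lambda>z. std_normal_density z * z)"
    using integrable_std_normal_moment[of 1] by (simp only: power_one_right)
  then show ?thesis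
    by (subst (asm) distributed_integrable[OF distributed_std_normal_id]) auto
qed

lemma expectation_std_normal: "(\<integral>z. z \<partial>std_normal) = 0"
  by (rule std_normal.standard_normal_distributed_expectation[OF distributed_std_normal_id])

lemma deriv_std_normal_density:
  "(std_normal_density has_real_derivative - z * std_normal_density z) (at z)"
  unfolding std_normal_density_def
  by (rule derivative_eq_intros refl | simp)+

lemma std_normal_density_at_top: "(std_normal_density \<longlongrightarrow> 0) at_top"
proof -
  have "((\<lambda>z::real. exp (- z\<^sup>2 / 2)) \<longlongrightarrow> 0) at_top" by real_asymp
  from tendsto_mult_right[OF this, of "1 / sqrt (2 * pi)"]
  show ?thesis by (simp add: std_normal_density_def[abs_def])
qed

text \<open>The antiderivative of \<open>z \<phi>(z)\<close> is \<open>-\<phi>(z)\<close>, which vanishes at infinity; this is the only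
  integral computed by the fundamental theorem of calculus, and the source of every occurrence of
  \<^const>\<open>phi_Phi_inv\<close> in the closed formulas.\<close>

lemma std_normal_tail_mean: "(\<integral>z. indicator {a..} z * z \<partial>std_normal) = std_normal_density a"
proof -
  have int: "integrable lborel (\<lambda>z. std_normal_density z * z)"
    using integrable_std_normal_moment[of 1] by simp
  have "(LBINT z=ereal a..\<infinity>. std_normal_density z * z) = 0 - (- std_normal_density a)"
  proof (rule interval_integral_FTC_integrable[where F = "\<lambda>z. - std_normal_density z"])
    show "((\<lambda>z. - std_normal_density z) has_vector_derivative std_normal_density z * z) (at z)" for z
      using DERIV_minus[OF deriv_std_normal_density[of z]]
      by (simp add: has_real_derivative_iff_has_vector_derivative mult.commute)
    show "isCont (\<lambda>z. std_normal_density z * z) z" for z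
      by (intro continuous_intros DERIV_isCont[OF deriv_std_normal_density])
    show "set_integrable lborel (einterval (ereal a) \<infinity>) (\<lambda>z. std_normal_density z * z)"
      unfolding set_integrable_def by (rule integrable_mult_indicator[OF _ int]) simp
    show "(((\<lambda>z. - std_normal_density z) \<circ> real_of_ereal) \<longlongrightarrow> - std_normal_density a)
        (at_right (ereal a))"
      unfolding ereal_tendsto_simps1
      using DERIV_isCont[OF deriv_std_normal_density[of a]]
      by (intro tendsto_minus) (simp add: isCont_def filterlim_at_split)
    show "(((\<lambda>z. - std_normal_density z) \<circ> real_of_ereal) \<longlongrightarrow> 0) (at_left \<infinity>)"
      unfolding ereal_tendsto_simps1
      using tendsto_minus[OF std_normal_density_at_top] by simp
  qed simp
  also have "(LBINT z=ereal a..\<infinity>. std_normal_density z * z) =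
      (\<integral>z. std_normal_density z * (indicator {a<..} z * z) \<partial>lborel)"
    by (simp add: interval_lebesgue_integral_def set_lebesgue_integral_def einterval_eq_Ici
        mult.left_commute)
  also have "\<dots> = (\<integral>z. indicator {a<..} z * z \<partial>std_normal)"
    by (rule distributed_integral[OF distributed_std_normal_id]) auto
  also have "\<dots> = (\<integral>z. indicator {a..} z * z \<partial>std_normal)"
  proof (rule integral_cong_AE)
    have "AE z in std_normal. z \<noteq> a"
      by (simp add: AE_density) (use AE_lborel_singleton[of a] in eventually_elim, auto)
    then show "AE z in std_normal. indicator {a<..} z * z = indicator {a..} z * z"
      by eventually_elim (auto simp: indicator_def)
  qed auto
  finally show ?thesis by simp
qed

text \<open>The integral vanishes for \<open>p \<le> 0\<close> because the distribution is centred and for \<open>p \<ge> 1\<close> because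
  the half line is empty, in agreement with the value 0 of \<^const>\<open>phi_Phi_inv\<close> off the open unit
  interval. The endpoints occur: for \<open>\<beta> = \<plusminus>1\<close> the angle \<open>\<gamma>\<^sub>0\<close> corresponds to \<open>p = 0\<close> or \<open>p = 1\<close>.\<close>

lemma std_normal_upper_mean:
  "(\<integral>z. indicator {z. p \<le> Phi z} z * z \<partial>std_normal) = phi_Phi_inv p"
proof -
  consider "p \<le> 0" | "1 \<le> p" | "0 < p" "p < 1" by linarith
  then show ?thesis
  proof cases
    case 1
    then have "p \<le> Phi z" for z using Phi_pos[of z] by linarith
    then show ?thesis using 1 by (simp add: phi_Phi_inv_def expectation_std_normal)
  next
    case 2
    then have "\<not> p \<le> Phi z" for z using Phi_less_1[of z] by linarith
    then show ?thesis using 2 by (simp add: phi_Phi_inv_def)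
  next
    case 3
    then have "{z. p \<le> Phi z} = {Phi_inv p..}" by (auto simp: Phi_inv_le_iff)
    then show ?thesis using 3 by (simp add: phi_Phi_inv_def std_normal_tail_mean)
  qed
qed

lemma std_normal_lower_mean:
  "(\<integral>z. indicator {z. Phi z \<le> p} z * z \<partial>std_normal) = - phi_Phi_inv p"
proof -
  have null: "AE z in std_normal. Phi z \<noteq> p"
  proof -
    have "AE z in std_normal. z \<noteq> Phi_inv p"
      by (simp add: AE_density) (use AE_lborel_singleton[of "Phi_inv p"] in eventually_elim, auto)
    then show ?thesis by eventually_elim (auto simp: Phi_inv_Phi)
  qed
  have [simp]: "integrable std_normal (\<lambda>z. indicator {z. p \<le> Phi z} z * z)"
    using integrable_mult_indicator[OF _ integrable_std_normal_id, of "{z. p \<le> Phi z}"]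
    by simp
  have "(\<integral>z. indicator {z. Phi z \<le> p} z * z \<partial>std_normal) =
      (\<integral>z. z - indicator {z. p \<le> Phi z} z * z \<partial>std_normal)"
    by (rule integral_cong_AE, simp, simp) (use null in eventually_elim, auto simp: indicator_def)
  also have "\<dots> = - phi_Phi_inv p"
    by (simp add: integrable_std_normal_id expectation_std_normal std_normal_upper_mean)
  finally show ?thesis .
qed

lemma prob_Phi_le:
  assumes "0 \<le> p" "p \<le> 1"
  shows "measure std_normal {z. Phi z \<le> p} = p"
proof -
  consider "p = 0" | "p = 1" | "0 < p" "p < 1" using assms by linarith
  then show ?thesis
  proof cases
    case 1
    then have "{z. Phi z \<le> p} = {}" using Phi_pos by (auto simp: not_le)
    then show ?thesis using 1 by simp
  next
    case 2
    then have "{z. Phi z \<le> p} = UNIV" using Phi_less_1 by (auto simp: less_imp_le)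
    then show ?thesis using 2 std_normal.prob_space by simp
  next
    case 3
    then have "{z. Phi z \<le> p} = {..Phi_inv p}"
      using Phi_le_iff[of _ "Phi_inv p"] by (auto simp: Phi_Phi_inv)
    then have "measure std_normal {z. Phi z \<le> p} = Phi (Phi_inv p)"
      unfolding Phi_eq_measure by (rule arg_cong)
    then show ?thesis using 3 by (simp only: Phi_Phi_inv)
  qed
qed

section \<open>The uniformly distributed angle\<close>

lemma borel_measurable_gam [measurable]: "gam \<in> borel_measurable borel"
  unfolding gam_def[abs_def] by measurable

lemma gam_bounds: "- (pi / 2) < gam z" "gam z < pi / 2"
  using mult_strict_left_mono[OF Phi_pos[of z] pi_gt_zero]
    mult_strict_left_mono[OF Phi_less_1[of z] pi_gt_zero]
  by (auto simp: gam_def)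

lemma gam_minus: "gam (- z) = - gam z"
  by (simp add: gam_def Phi_minus algebra_simps)

lemma gam_le_iff: "gam z \<le> t \<longleftrightarrow> Phi z \<le> 1 / pi * (t + pi / 2)"
  by (simp add: gam_def field_simps)

lemma Phi_eq_gam: "Phi z = 1 / pi * (gam z + pi / 2)"
  by (simp add: gam_def)

text \<open>This is the probability integral transform, scaled to the interval \<open>[-\<pi>/2, \<pi>/2]\<close>.\<close>

lemma distributed_gam:
  "distributed std_normal lborel gam
    (\<lambda>\<gamma>. indicator {- (pi / 2)..pi / 2} \<gamma> / measure lborel {- (pi / 2)..pi / 2})"
proof (rule std_normal.uniform_distrI_borel_atLeastAtMost)
  fix t :: real assume t: "- (pi / 2) \<le> t" "t \<le> pi / 2"
  have "{z \<in> space std_normal. gam z \<le> t} = {z. Phi z \<le> 1 / pi * (t + pi / 2)}"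
    by (auto simp: gam_le_iff)
  then have "measure std_normal {z \<in> space std_normal. gam z \<le> t} = 1 / pi * (t + pi / 2)"
    using t by (simp only:) (rule prob_Phi_le; simp add: field_simps)
  then show "measure std_normal {z \<in> space std_normal. gam z \<le> t} =
      (t - - (pi / 2)) / (pi / 2 - - (pi / 2))"
    by (simp add: field_simps)
qed auto

text \<open>The change of variables \<open>\<gamma> = gam z\<close> is carried out on laws: \<^const>\<open>gam\<close> has constant density
  \<open>1/\<pi>\<close>. Done this way it asks for measurability only, so the singularities of the closed formulas
  at the ends of the interval are harmless.\<close>

lemma expectation_above_angle:
  assumes f [measurable]: "f \<in> borel_measurable borel"
    and g: "- (pi / 2) \<le> g" "g \<le> pi / 2"
  shows "(\<integral>z. indicator {z. g < gam z} z * f (gam z) \<partial>std_normal) =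
    1 / pi * (LBINT \<gamma>=ereal g..ereal (pi / 2). f \<gamma>)"
proof -
  let ?h = "\<lambda>\<gamma>. indicator {g<..<pi / 2} \<gamma> * f \<gamma>"
  have "(\<integral>z. indicator {z. g < gam z} z * f (gam z) \<partial>std_normal) = (\<integral>z. ?h (gam z) \<partial>std_normal)"
    using gam_bounds by (intro Bochner_Integration.integral_cong) (auto simp: indicator_def)
  also have "\<dots> = (\<integral>\<gamma>. indicator {- (pi / 2)..pi / 2} \<gamma> / measure lborel {- (pi / 2)..pi / 2} * ?h \<gamma> \<partial>lborel)"
    by (rule distributed_integral[OF distributed_gam, symmetric]) auto
  also have "\<dots> = (\<integral>\<gamma>. 1 / pi * ?h \<gamma> \<partial>lborel)"
    using g by (intro Bochner_Integration.integral_cong) (auto simp: indicator_def)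
  also have "\<dots> = 1 / pi * (\<integral>\<gamma>. ?h \<gamma> \<partial>lborel)"
    by (rule integral_mult_right_zero)
  also have "(\<integral>\<gamma>. ?h \<gamma> \<partial>lborel) = (LBINT \<gamma>=ereal g..ereal (pi / 2). f \<gamma>)"
    using g by (simp add: interval_lebesgue_integral_def set_lebesgue_integral_def einterval_eq)
  finally show ?thesis .
qed

section \<open>The sublevel sets of the stable representation\<close>

lemma W_fun_pos: "0 < W_fun z"
  using Phi_pos[of z] Phi_less_1[of z] by (simp add: W_fun_def)

lemma le_W_fun_iff: "t \<le> W_fun z \<longleftrightarrow> 1 - exp (- t) \<le> Phi z"
proof -
  have "t \<le> W_fun z \<longleftrightarrow> ln (1 - Phi z) \<le> ln (exp (- t))"
    by (auto simp: W_fun_def)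
  also have "\<dots> \<longleftrightarrow> 1 - Phi z \<le> exp (- t)"
    using Phi_less_1[of z] by (subst ln_le_cancel_iff) auto
  finally show ?thesis by auto
qed

lemma inj_W_fun: "inj W_fun"
proof (rule injI)
  fix y z assume "W_fun y = W_fun z"
  then have "Phi y = Phi z"
    using Phi_less_1[of y] Phi_less_1[of z] by (simp add: W_fun_def)
  then show "y = z" using inj_Phi by (simp add: inj_eq)
qed

lemma gamma0_eq:
  assumes "0 < \<alpha>" "\<alpha> < 1"
  shows "gamma0 \<alpha> \<beta> = - (\<beta> * (pi / 2))"
  using assms by (simp add: gamma0_def K_fun_def)

lemma gamma0_minus: "gamma0 \<alpha> (- \<beta>) = - gamma0 \<alpha> \<beta>"
  by (simp add: gamma0_def)

lemma gamma0_bounds: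
  assumes "0 < \<alpha>" "\<alpha> < 1" "-1 \<le> \<beta>" "\<beta> \<le> 1"
  shows "- (pi / 2) \<le> gamma0 \<alpha> \<beta>" "gamma0 \<alpha> \<beta> \<le> pi / 2"
  using mult_right_mono[OF assms(3), of "pi / 2"] mult_right_mono[OF assms(4), of "pi / 2"]
  by (auto simp: gamma0_eq[OF assms(1,2)])

lemma G0_minus: "G0 \<alpha> (- \<beta>) (- z1) z2 = - G0 \<alpha> \<beta> z1 z2"
proof -
  have "\<alpha> * (- gam z1 - - gamma0 \<alpha> \<beta>) = - (\<alpha> * (gam z1 - gamma0 \<alpha> \<beta>))"
    by (simp add: algebra_simps)
  moreover have "- gam z1 - \<alpha> * (- gam z1 - - gamma0 \<alpha> \<beta>) = - (gam z1 - \<alpha> * (gam z1 - gamma0 \<alpha> \<beta>))"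
    by (simp add: algebra_simps)
  ultimately show ?thesis
    unfolding G0_def gam_minus gamma0_minus by (simp only: sin_minus cos_minus)
qed

lemma borel_measurable_a_fun [measurable]: "a_fun \<alpha> \<beta> \<in> borel_measurable borel"
  unfolding a_fun_def[abs_def] by measurable

lemma borel_measurable_G0 [measurable (raw)]:
  assumes [measurable]: "f \<in> borel_measurable M" "g \<in> borel_measurable M"
  shows "(\<lambda>\<omega>. G0 \<alpha> \<beta> (f \<omega>) (g \<omega>)) \<in> borel_measurable M"
  unfolding G0_def W_fun_def by measurable

text \<open>Since \<open>\<gamma> - \<alpha> (\<gamma> - \<gamma>\<^sub>0)\<close> is a convex combination of \<open>\<gamma>\<close> and \<open>\<gamma>\<^sub>0\<close>, with positive weight
  on \<open>\<gamma>\<close>, it stays in the open interval where the cosine is positive; and \<open>\<alpha> \<bar>\<gamma> - \<gamma>\<^sub>0\<bar> < \<pi>\<close> gives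
  the sine the sign of \<open>\<gamma> - \<gamma>\<^sub>0\<close>.\<close>

lemma angle_signs:
  assumes \<alpha>: "0 < \<alpha>" "\<alpha> < 1" and \<gamma>: "- (pi / 2) < \<gamma>" "\<gamma> < pi / 2"
    and g: "- (pi / 2) \<le> g" "g \<le> pi / 2"
  shows cos_angle_pos: "0 < cos \<gamma>"
    and cos_mixed_angle_pos: "0 < cos (\<gamma> - \<alpha> * (\<gamma> - g))"
    and sin_angle_pos: "g < \<gamma> \<Longrightarrow> 0 < sin (\<alpha> * (\<gamma> - g))"
    and sin_angle_nonpos: "\<gamma> \<le> g \<Longrightarrow> sin (\<alpha> * (\<gamma> - g)) \<le> 0"
proof -
  show "0 < cos \<gamma>" using \<gamma> by (intro cos_gt_zero_pi) auto
  have mix: "\<gamma> - \<alpha> * (\<gamma> - g) = (1 - \<alpha>) * \<gamma> + \<alpha> * g" by (simp add: algebra_simps)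
  have "(1 - \<alpha>) * \<gamma> < (1 - \<alpha>) * (pi / 2)" "(1 - \<alpha>) * (- (pi / 2)) < (1 - \<alpha>) * \<gamma>"
    using \<alpha> \<gamma> by (intro mult_strict_left_mono; simp)+
  moreover have "\<alpha> * g \<le> \<alpha> * (pi / 2)" "\<alpha> * (- (pi / 2)) \<le> \<alpha> * g"
    using \<alpha> g by (intro mult_left_mono; simp)+
  moreover have "(1 - \<alpha>) * (pi / 2) + \<alpha> * (pi / 2) = pi / 2"
    "(1 - \<alpha>) * (- (pi / 2)) + \<alpha> * (- (pi / 2)) = - (pi / 2)"
    by (simp_all add: field_simps)
  ultimately show "0 < cos (\<gamma> - \<alpha> * (\<gamma> - g))"
    unfolding mix by (intro cos_gt_zero_pi) linarith+
  have scaled: "\<alpha> * t < pi" if "0 < t" "t < pi" for t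
    using mult_strict_right_mono[OF \<alpha>(2) that(1)] that(2) by simp
  show "0 < sin (\<alpha> * (\<gamma> - g))" if "g < \<gamma>"
    using that \<alpha> \<gamma> g scaled[of "\<gamma> - g"] by (intro sin_gt_zero) auto
  show "sin (\<alpha> * (\<gamma> - g)) \<le> 0" if "\<gamma> \<le> g"
  proof (cases "\<gamma> = g")
    case False
    have "0 < sin (\<alpha> * (g - \<gamma>))"
      using that False \<alpha> \<gamma> g scaled[of "g - \<gamma>"] by (intro sin_gt_zero) auto
    moreover have "\<alpha> * (\<gamma> - g) = - (\<alpha> * (g - \<gamma>))" by (simp add: algebra_simps)
    ultimately show ?thesis by (simp only: sin_minus)
  qed simp
qed

lemma a_fun_pos:
  assumes "0 < \<alpha>" "\<alpha> < 1" "-1 \<le> \<beta>" "\<beta> \<le> 1" "gamma0 \<alpha> \<beta> < \<gamma>" "\<gamma> < pi / 2"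
  shows "0 < a_fun \<alpha> \<beta> \<gamma>"
proof -
  note g = gamma0_bounds[OF assms(1-4)]
  have "- (pi / 2) < \<gamma>" using g assms by linarith
  note signs = angle_signs[OF assms(1,2) this assms(6) g]
  show ?thesis
    unfolding a_fun_def using signs(1,2) signs(3)[OF assms(5)]
    by (intro mult_pos_pos divide_pos_pos) simp_all
qed

text \<open>Taking logarithms turns \<open>G\<^sub>0 \<le> x\<close> into a linear inequality for \<open>ln W\<close>, and solving it for
  \<open>W\<close> produces the function \<open>a\<close>.\<close>

lemma G0_le_pos_iff:
  assumes \<alpha>: "0 < \<alpha>" "\<alpha> < 1" and \<beta>: "-1 \<le> \<beta>" "\<beta> \<le> 1" and x: "0 < x"
  shows "G0 \<alpha> \<beta> z1 z2 \<le> x \<longleftrightarrow> gam z1 \<le> gamma0 \<alpha> \<beta> \<or>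
    1 - exp (- (x powr (\<alpha> / (\<alpha> - 1)) * a_fun \<alpha> \<beta> (gam z1))) \<le> Phi z2"
proof -
  define g where "g = gamma0 \<alpha> \<beta>"
  define S where "S = sin (\<alpha> * (gam z1 - g))"
  define C where "C = cos (gam z1)"
  define D where "D = cos (gam z1 - \<alpha> * (gam z1 - g))"
  note signs = angle_signs[OF \<alpha> gam_bounds gamma0_bounds[OF \<alpha> \<beta>], of z1, folded g_def]
  have C: "0 < C" and D: "0 < D" using signs(1,2) by (auto simp: C_def D_def)
  have W: "0 < W_fun z2" by (rule W_fun_pos)
  have G0: "G0 \<alpha> \<beta> z1 z2 = S / C powr (1 / \<alpha>) * (D / W_fun z2) powr ((1 - \<alpha>) / \<alpha>)"
    by (simp add: G0_def S_def C_def D_def g_def)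
  have a: "a_fun \<alpha> \<beta> (gam z1) = (S / C) powr (\<alpha> / (1 - \<alpha>)) * (D / C)"
    by (simp add: a_fun_def S_def C_def D_def g_def)
  show ?thesis
  proof (cases "gam z1 \<le> g")
    case True
    then have "S \<le> 0" using signs(4) by (simp add: S_def)
    then have "G0 \<alpha> \<beta> z1 z2 \<le> 0"
      unfolding G0 by (intro mult_nonpos_nonneg divide_nonpos_nonneg) auto
    then show ?thesis using True x by (auto simp: g_def)
  next
    case False
    then have S: "0 < S" using signs(3) by (simp add: S_def)
    have lnG0: "ln (G0 \<alpha> \<beta> z1 z2) =
        ln S - 1 / \<alpha> * ln C + (1 - \<alpha>) / \<alpha> * (ln D - ln (W_fun z2))"
      unfolding G0 using S C D W by (simp add: ln_mult ln_div ln_powr)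
    have lna: "ln (x powr (\<alpha> / (\<alpha> - 1)) * a_fun \<alpha> \<beta> (gam z1)) =
        \<alpha> / (\<alpha> - 1) * ln x + (\<alpha> / (1 - \<alpha>) * (ln S - ln C) + (ln D - ln C))"
      unfolding a using S C D x by (simp add: ln_mult ln_div ln_powr)
    have "G0 \<alpha> \<beta> z1 z2 \<le> x \<longleftrightarrow> ln (G0 \<alpha> \<beta> z1 z2) \<le> ln x"
      unfolding G0 using S C D W x by (subst ln_le_cancel_iff) auto
    also have "\<dots> \<longleftrightarrow> \<alpha> * ln S - ln C + (1 - \<alpha>) * ln D - \<alpha> * ln x \<le> (1 - \<alpha>) * ln (W_fun z2)"
    proof -
      have "ln (G0 \<alpha> \<beta> z1 z2) \<le> ln x \<longleftrightarrow> \<alpha> * ln (G0 \<alpha> \<beta> z1 z2) \<le> \<alpha> * ln x"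
        using \<alpha>(1) by simp
      also have "\<alpha> * ln (G0 \<alpha> \<beta> z1 z2) =
          \<alpha> * ln S - ln C + (1 - \<alpha>) * (ln D - ln (W_fun z2))"
        unfolding lnG0 using \<alpha>(1) by (simp add: distrib_left right_diff_distrib)
      finally show ?thesis by (auto simp: right_diff_distrib)
    qed
    also have "\<alpha> * ln S - ln C + (1 - \<alpha>) * ln D - \<alpha> * ln x =
        (1 - \<alpha>) * ln (x powr (\<alpha> / (\<alpha> - 1)) * a_fun \<alpha> \<beta> (gam z1))"
    proof -
      have "(1 - \<alpha>) * (\<alpha> / (\<alpha> - 1)) = - \<alpha>" "(1 - \<alpha>) * (\<alpha> / (1 - \<alpha>)) = \<alpha>"
        using \<alpha>(2) by (simp_all add: field_simps)
      then show ?thesis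
        unfolding lna distrib_left mult.assoc[symmetric] by (simp add: algebra_simps)
    qed
    also have "(1 - \<alpha>) * ln (x powr (\<alpha> / (\<alpha> - 1)) * a_fun \<alpha> \<beta> (gam z1)) \<le> (1 - \<alpha>) * ln (W_fun z2)
        \<longleftrightarrow> ln (x powr (\<alpha> / (\<alpha> - 1)) * a_fun \<alpha> \<beta> (gam z1)) \<le> ln (W_fun z2)"
      using \<alpha>(2) by simp
    also have "\<dots> \<longleftrightarrow> x powr (\<alpha> / (\<alpha> - 1)) * a_fun \<alpha> \<beta> (gam z1) \<le> W_fun z2"
      unfolding a using S C D W x by (subst ln_le_cancel_iff) auto
    finally show ?thesis using False by (simp add: le_W_fun_iff g_def)
  qed
qed

lemma G0_le_zero_iff:
  assumes \<alpha>: "0 < \<alpha>" "\<alpha> < 1" and \<beta>: "-1 \<le> \<beta>" "\<beta> \<le> 1"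
  shows "G0 \<alpha> \<beta> z1 z2 \<le> 0 \<longleftrightarrow> gam z1 \<le> gamma0 \<alpha> \<beta>"
proof -
  note signs = angle_signs[OF \<alpha> gam_bounds gamma0_bounds[OF \<alpha> \<beta>], of z1]
  have C: "0 < cos (gam z1) powr (1 / \<alpha>)" using signs(1) by simp
  have D: "0 < (cos (gam z1 - \<alpha> * (gam z1 - gamma0 \<alpha> \<beta>)) / W_fun z2) powr ((1 - \<alpha>) / \<alpha>)"
    using signs(2) W_fun_pos[of z2] by simp
  have "G0 \<alpha> \<beta> z1 z2 \<le> 0 \<longleftrightarrow> sin (\<alpha> * (gam z1 - gamma0 \<alpha> \<beta>)) \<le> 0"
    using C D by (auto simp: G0_def mult_le_0_iff divide_le_0_iff)
  also have "\<dots> \<longleftrightarrow> gam z1 \<le> gamma0 \<alpha> \<beta>"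
    using signs(3,4) by (auto simp: not_less not_le[symmetric])
  finally show ?thesis .
qed

text \<open>A nonzero value forces a nonzero sine, and the remaining factor is strictly monotone in \<open>W\<close>.
  Each nonzero level therefore meets a line of constant \<open>z\<^sub>1\<close> in at most one point, which makes the
  nonzero level sets null sets.\<close>

lemma G0_eq_nonzero_unique:
  assumes \<alpha>: "0 < \<alpha>" "\<alpha> < 1" and \<beta>: "-1 \<le> \<beta>" "\<beta> \<le> 1"
    and y: "y \<noteq> 0" "G0 \<alpha> \<beta> z1 z2 = y" "G0 \<alpha> \<beta> z1 z2' = y"
  shows "z2 = z2'"
proof -
  define D where "D = cos (gam z1 - \<alpha> * (gam z1 - gamma0 \<alpha> \<beta>))"
  have D: "0 < D"
    using angle_signs(2)[OF \<alpha> gam_bounds gamma0_bounds[OF \<alpha> \<beta>], of z1] by (simp add: D_def)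
  have "(D / W_fun z2) powr ((1 - \<alpha>) / \<alpha>) = (D / W_fun z2') powr ((1 - \<alpha>) / \<alpha>)"
    using y by (auto simp: G0_def D_def)
  then have "ln ((D / W_fun z2) powr ((1 - \<alpha>) / \<alpha>)) = ln ((D / W_fun z2') powr ((1 - \<alpha>) / \<alpha>))"
    by (rule arg_cong)
  then have "ln (D / W_fun z2) = ln (D / W_fun z2')"
    using \<alpha> D W_fun_pos[of z2] W_fun_pos[of z2'] by (simp add: ln_powr)
  then have "W_fun z2 = W_fun z2'"
    using D W_fun_pos[of z2] W_fun_pos[of z2'] by (simp add: ln_div)
  then show ?thesis by (rule injD[OF inj_W_fun])
qed

section \<open>The Hermite coefficients of order one\<close>

lemma Hermite_0: "Hermite 0 u = 1"
  using normal_density_pos[of 1 0 u] by (simp add: Hermite_def)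

lemma Hermite_1: "Hermite 1 u = u"
proof -
  have "deriv std_normal_density u = - u * std_normal_density u"
    by (rule DERIV_imp_deriv[OF deriv_std_normal_density])
  then show ?thesis
    using normal_density_pos[of 1 0 u] by (simp add: Hermite_def)
qed

text \<open>The pair is abstracted into a locale because the reflection argument applies the same facts to
  a second pair, \<open>(-Z\<^sub>1, Z\<^sub>2)\<close>.\<close>

locale independent_std_normals = prob_space +
  fixes Z1 Z2 :: "'a \<Rightarrow> real"
  assumes Z1: "distributed M lborel Z1 std_normal_density"
    and Z2: "distributed M lborel Z2 std_normal_density"
    and indep: "indep_var borel Z1 borel Z2"
begin

lemma measurable_Z1 [measurable]: "Z1 \<in> borel_measurable M"
  and measurable_Z2 [measurable]: "Z2 \<in> borel_measurable M"
  using distributed_measurable[OF Z1] distributed_measurable[OF Z2] by simp_all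

lemma distr_std_normal:
  assumes "distributed M lborel X std_normal_density"
  shows "distr M borel X = std_normal"
proof -
  have "distr M borel X = distr M lborel X" by (rule distr_cong) simp_all
  then show ?thesis using distributed_distr_eq_density[OF assms] by simp
qed

lemma joint_law: "distr M (borel \<Otimes>\<^sub>M borel) (\<lambda>\<omega>. (Z1 \<omega>, Z2 \<omega>)) = std_normal \<Otimes>\<^sub>M std_normal"
  using indep unfolding indep_var_distribution_eq by (simp add: distr_std_normal Z1 Z2)

lemma expectation_iterated:
  fixes f :: "real \<times> real \<Rightarrow> real"
  assumes f [measurable]: "f \<in> borel_measurable (borel \<Otimes>\<^sub>M borel)"
    and int: "integrable M (\<lambda>\<omega>. f (Z1 \<omega>, Z2 \<omega>))"
  shows "expectation (\<lambda>\<omega>. f (Z1 \<omega>, Z2 \<omega>)) = (\<integral>z1. \<integral>z2. f (z1, z2) \<partial>std_normal \<partial>std_normal)"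
proof -
  interpret pair_sigma_finite std_normal std_normal ..
  have "integrable (std_normal \<Otimes>\<^sub>M std_normal) f"
    unfolding joint_law[symmetric] using int by (subst integrable_distr_eq) auto
  then have "(\<integral>z1. \<integral>z2. f (z1, z2) \<partial>std_normal \<partial>std_normal) = (\<integral>z. f z \<partial>(std_normal \<Otimes>\<^sub>M std_normal))"
    by (rule integral_fst')
  also have "\<dots> = expectation (\<lambda>\<omega>. f (Z1 \<omega>, Z2 \<omega>))"
    unfolding joint_law[symmetric] by (rule integral_distr) auto
  finally show ?thesis by simp
qed

lemma integrable_std_normal_var:
  assumes "distributed M lborel X std_normal_density"
  shows "integrable M X"
  using integrable_std_normal_moment[of 1]
  by (intro distributed_integrable_var[OF assms]) (simp_all only: normal_density_nonneg power_one_right)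

lemma integrable_indicator_mult:
  assumes "distributed M lborel X std_normal_density" and [measurable]: "Measurable.pred M P"
  shows "integrable M (\<lambda>\<omega>. of_bool (P \<omega>) * X \<omega>)"
proof (rule Bochner_Integration.integrable_bound[OF integrable_std_normal_var[OF assms(1)]])
  have [measurable]: "X \<in> borel_measurable M"
    using distributed_measurable[OF assms(1)] by simp
  show "(\<lambda>\<omega>. of_bool (P \<omega>) * X \<omega>) \<in> borel_measurable M" by measurable
qed simp

lemma Hermite_coeff_1_0:
  "Hermite_coeff M Z1 Z2 \<alpha> 1 0 x \<beta> = expectation (\<lambda>\<omega>. of_bool (G0 \<alpha> \<beta> (Z1 \<omega>) (Z2 \<omega>) \<le> x) * Z1 \<omega>)"
  unfolding Hermite_coeff_def Hermite_0 Hermite_1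
  by (intro Bochner_Integration.integral_cong) (auto simp: indicator_def)

lemma Hermite_coeff_0_1:
  "Hermite_coeff M Z1 Z2 \<alpha> 0 1 x \<beta> = expectation (\<lambda>\<omega>. of_bool (G0 \<alpha> \<beta> (Z1 \<omega>) (Z2 \<omega>) \<le> x) * Z2 \<omega>)"
  unfolding Hermite_coeff_def Hermite_0 Hermite_1
  by (intro Bochner_Integration.integral_cong) (auto simp: indicator_def)

text \<open>The iterated forms evaluate the coefficients, and they also show that these depend only on the
  parameters and not on the pair, so that \<open>(Z\<^sub>1, Z\<^sub>2)\<close> and \<open>(-Z\<^sub>1, Z\<^sub>2)\<close> share them.\<close>

lemma Hermite_coeff_1_0_iterated:
  "Hermite_coeff M Z1 Z2 \<alpha> 1 0 x \<beta> =
    (\<integral>z1. z1 * measure std_normal {z2. G0 \<alpha> \<beta> z1 z2 \<le> x} \<partial>std_normal)"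
proof -
  have "Hermite_coeff M Z1 Z2 \<alpha> 1 0 x \<beta> =
      (\<integral>z1. \<integral>z2. of_bool (G0 \<alpha> \<beta> z1 z2 \<le> x) * z1 \<partial>std_normal \<partial>std_normal)"
    unfolding Hermite_coeff_1_0
    using expectation_iterated[of "\<lambda>z. of_bool (G0 \<alpha> \<beta> (fst z) (snd z) \<le> x) * fst z"]
      integrable_indicator_mult[OF Z1] by simp
  also have "\<dots> = (\<integral>z1. z1 * measure std_normal {z2. G0 \<alpha> \<beta> z1 z2 \<le> x} \<partial>std_normal)"
  proof (rule Bochner_Integration.integral_cong[OF refl])
    fix z1
    have "(\<integral>z2. of_bool (G0 \<alpha> \<beta> z1 z2 \<le> x) * z1 \<partial>std_normal) =
        (\<integral>z2. indicator {z2. G0 \<alpha> \<beta> z1 z2 \<le> x} z2 * z1 \<partial>std_normal)"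
      by (intro Bochner_Integration.integral_cong) (auto simp: indicator_def)
    also have "\<dots> = z1 * measure std_normal {z2. G0 \<alpha> \<beta> z1 z2 \<le> x}"
      by simp
    finally show "(\<integral>z2. of_bool (G0 \<alpha> \<beta> z1 z2 \<le> x) * z1 \<partial>std_normal) =
        z1 * measure std_normal {z2. G0 \<alpha> \<beta> z1 z2 \<le> x}" .
  qed
  finally show ?thesis .
qed

lemma Hermite_coeff_0_1_iterated:
  "Hermite_coeff M Z1 Z2 \<alpha> 0 1 x \<beta> =
    (\<integral>z1. \<integral>z2. indicator {z2. G0 \<alpha> \<beta> z1 z2 \<le> x} z2 * z2 \<partial>std_normal \<partial>std_normal)"
proof -
  have "Hermite_coeff M Z1 Z2 \<alpha> 0 1 x \<beta> =
      (\<integral>z1. \<integral>z2. of_bool (G0 \<alpha> \<beta> z1 z2 \<le> x) * z2 \<partial>std_normal \<partial>std_normal)"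
    unfolding Hermite_coeff_0_1
    using expectation_iterated[of "\<lambda>z. of_bool (G0 \<alpha> \<beta> (fst z) (snd z) \<le> x) * snd z"]
      integrable_indicator_mult[OF Z2] by simp
  also have "\<dots> = (\<integral>z1. \<integral>z2. indicator {z2. G0 \<alpha> \<beta> z1 z2 \<le> x} z2 * z2 \<partial>std_normal \<partial>std_normal)"
    by (intro Bochner_Integration.integral_cong refl) (auto simp: indicator_def)
  finally show ?thesis .
qed

lemma independent_std_normals_minus: "independent_std_normals M (\<lambda>\<omega>. - Z1 \<omega>) Z2"
proof
  show "distributed M lborel (\<lambda>\<omega>. - Z1 \<omega>) std_normal_density"
    using normal_density_affine[OF Z1, of "-1" 0] by simp
  show "indep_var borel (\<lambda>\<omega>. - Z1 \<omega>) borel Z2"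
    using indep_var_compose[OF indep, of uminus borel "\<lambda>z. z" borel] by (simp add: comp_def)
qed (rule Z2)

lemma AE_G0_neq:
  assumes \<alpha>: "0 < \<alpha>" "\<alpha> < 1" and \<beta>: "-1 \<le> \<beta>" "\<beta> \<le> 1" and y: "y \<noteq> 0"
  shows "AE \<omega> in M. G0 \<alpha> \<beta> (Z1 \<omega>) (Z2 \<omega>) \<noteq> y"
proof -
  interpret pair_sigma_finite std_normal std_normal ..
  have "AE z2 in std_normal. G0 \<alpha> \<beta> z1 z2 \<noteq> y" for z1
  proof (cases "\<exists>z. G0 \<alpha> \<beta> z1 z = y")
    case True
    then obtain z where z: "G0 \<alpha> \<beta> z1 z = y" ..
    have "AE z2 in std_normal. z2 \<noteq> z"
      by (simp add: AE_density) (use AE_lborel_singleton[of z] in eventually_elim, auto)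
    then show ?thesis
      by eventually_elim (use G0_eq_nonzero_unique[OF \<alpha> \<beta> y _ z] in blast)
  qed simp
  moreover have "Measurable.pred (std_normal \<Otimes>\<^sub>M std_normal) (\<lambda>z. G0 \<alpha> \<beta> (fst z) (snd z) \<noteq> y)"
    by measurable
  ultimately have "AE z in std_normal \<Otimes>\<^sub>M std_normal. G0 \<alpha> \<beta> (fst z) (snd z) \<noteq> y"
    by (intro AE_pair_measure predE) simp_all
  then show ?thesis
    unfolding joint_law[symmetric] by (subst (asm) AE_distr_iff) auto
qed

text \<open>The flip \<open>(z\<^sub>1, \<beta>) \<mapsto> (-z\<^sub>1, -\<beta>)\<close> changes the sign of \<^const>\<open>G0\<close> and preserves the law of
  the pair, so it turns the sublevel set at \<open>x\<close> into the superlevel set at \<open>-x\<close>. The latter is, up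
  to a null set, the complement of a sublevel set, and complementing only changes the sign because
  \<open>Z\<^sub>1\<close> and \<open>Z\<^sub>2\<close> are centred. For \<open>Z\<^sub>1\<close> the flip contributes a second sign.\<close>

lemma Hermite_coeff_reflect:
  assumes \<alpha>: "0 < \<alpha>" "\<alpha> < 1" and \<beta>: "-1 \<le> \<beta>" "\<beta> \<le> 1" and x: "x \<noteq> 0"
  shows Hermite_coeff_1_0_reflect:
      "Hermite_coeff M Z1 Z2 \<alpha> 1 0 x \<beta> = Hermite_coeff M Z1 Z2 \<alpha> 1 0 (- x) (- \<beta>)"
    and Hermite_coeff_0_1_reflect:
      "Hermite_coeff M Z1 Z2 \<alpha> 0 1 x \<beta> = - Hermite_coeff M Z1 Z2 \<alpha> 0 1 (- x) (- \<beta>)"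
proof -
  interpret flip: independent_std_normals M "\<lambda>\<omega>. - Z1 \<omega>" Z2
    by (rule independent_std_normals_minus)
  have G0: "G0 \<alpha> \<beta> (Z1 \<omega>) (Z2 \<omega>) = - G0 \<alpha> (- \<beta>) (- Z1 \<omega>) (Z2 \<omega>)" for \<omega>
    by (simp add: G0_minus)
  have ae: "AE \<omega> in M. of_bool (G0 \<alpha> \<beta> (Z1 \<omega>) (Z2 \<omega>) \<le> x) * X \<omega> =
      X \<omega> - of_bool (G0 \<alpha> (- \<beta>) (- Z1 \<omega>) (Z2 \<omega>) \<le> - x) * X \<omega>" for X :: "'a \<Rightarrow> real"
    using flip.AE_G0_neq[OF \<alpha>, of "- \<beta>" "- x"] \<beta> x
    by (auto elim!: eventually_mono simp: G0 of_bool_def)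
  have complement: "expectation (\<lambda>\<omega>. of_bool (G0 \<alpha> \<beta> (Z1 \<omega>) (Z2 \<omega>) \<le> x) * X \<omega>) =
      - expectation (\<lambda>\<omega>. of_bool (G0 \<alpha> (- \<beta>) (- Z1 \<omega>) (Z2 \<omega>) \<le> - x) * X \<omega>)"
    if X: "distributed M lborel X std_normal_density" for X
  proof -
    have [measurable]: "X \<in> borel_measurable M"
      using distributed_measurable[OF X] by simp
    have "expectation (\<lambda>\<omega>. of_bool (G0 \<alpha> \<beta> (Z1 \<omega>) (Z2 \<omega>) \<le> x) * X \<omega>) =
        expectation (\<lambda>\<omega>. X \<omega> - of_bool (G0 \<alpha> (- \<beta>) (- Z1 \<omega>) (Z2 \<omega>) \<le> - x) * X \<omega>)"
      by (rule integral_cong_AE[OF _ _ ae]) measurable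
    also have "\<dots> = expectation X -
        expectation (\<lambda>\<omega>. of_bool (G0 \<alpha> (- \<beta>) (- Z1 \<omega>) (Z2 \<omega>) \<le> - x) * X \<omega>)"
      by (intro Bochner_Integration.integral_diff integrable_std_normal_var
          integrable_indicator_mult X) measurable
    finally show ?thesis
      by (simp add: standard_normal_distributed_expectation[OF X])
  qed
  have "Hermite_coeff M Z1 Z2 \<alpha> 1 0 x \<beta> = Hermite_coeff M (\<lambda>\<omega>. - Z1 \<omega>) Z2 \<alpha> 1 0 (- x) (- \<beta>)"
    unfolding Hermite_coeff_1_0 flip.Hermite_coeff_1_0 complement[OF Z1] by simp
  then show "Hermite_coeff M Z1 Z2 \<alpha> 1 0 x \<beta> = Hermite_coeff M Z1 Z2 \<alpha> 1 0 (- x) (- \<beta>)"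
    unfolding Hermite_coeff_1_0_iterated flip.Hermite_coeff_1_0_iterated .
  have "Hermite_coeff M Z1 Z2 \<alpha> 0 1 x \<beta> = - Hermite_coeff M (\<lambda>\<omega>. - Z1 \<omega>) Z2 \<alpha> 0 1 (- x) (- \<beta>)"
    unfolding Hermite_coeff_0_1 flip.Hermite_coeff_0_1 complement[OF Z2] by simp
  then show "Hermite_coeff M Z1 Z2 \<alpha> 0 1 x \<beta> = - Hermite_coeff M Z1 Z2 \<alpha> 0 1 (- x) (- \<beta>)"
    unfolding Hermite_coeff_0_1_iterated flip.Hermite_coeff_0_1_iterated .
qed

text \<open>Over an angle above \<open>\<gamma>\<^sub>0\<close> the section is a half line of probability \<open>exp (- c(\<gamma>))\<close>, and the
  factor \<open>Z\<^sub>1\<close> becomes a quantile when it is expressed through the angle.\<close>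

lemma Hermite_coeff_1_0_pos:
  assumes \<alpha>: "0 < \<alpha>" "\<alpha> < 1" and \<beta>: "-1 \<le> \<beta>" "\<beta> \<le> 1" and x: "0 < x"
  shows "Hermite_coeff M Z1 Z2 \<alpha> 1 0 x \<beta> = J10_formula \<alpha> x \<beta>"
proof -
  define g where "g = gamma0 \<alpha> \<beta>"
  define c where "c \<gamma> = x powr (\<alpha> / (\<alpha> - 1)) * a_fun \<alpha> \<beta> \<gamma>" for \<gamma>
  have c_measurable [measurable]: "c \<in> borel_measurable borel"
    unfolding c_def[abs_def] by measurable
  have g: "- (pi / 2) \<le> g" "g \<le> pi / 2"
    using gamma0_bounds[OF \<alpha> \<beta>] by (auto simp: g_def)
  have c_pos: "0 < c (gam z1)" if "g < gam z1" for z1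
    using a_fun_pos[OF \<alpha> \<beta>] that gam_bounds x by (simp add: c_def g_def)
  have inner: "measure std_normal {z2. G0 \<alpha> \<beta> z1 z2 \<le> x} =
      indicator {z. gam z \<le> g} z1 + indicator {z. g < gam z} z1 * exp (- c (gam z1))" for z1
  proof (cases "gam z1 \<le> g")
    case True
    then have "{z2. G0 \<alpha> \<beta> z1 z2 \<le> x} = UNIV"
      by (auto simp: G0_le_pos_iff[OF \<alpha> \<beta> x] g_def)
    then show ?thesis using True std_normal.prob_space by simp
  next
    case False
    then have "{z2. G0 \<alpha> \<beta> z1 z2 \<le> x} = {z2. 1 - exp (- c (gam z1)) \<le> Phi z2}"
      by (auto simp: G0_le_pos_iff[OF \<alpha> \<beta> x] g_def c_def)
    moreover have "measure std_normal {z2. 1 - exp (- c (gam z1)) \<le> Phi z2} = exp (- c (gam z1))"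
      using c_pos[of z1] False by (subst prob_Phi_ge) auto
    ultimately show ?thesis using False by simp
  qed
  have int1: "integrable std_normal (\<lambda>z. indicator {z. gam z \<le> g} z * z)"
    by (rule Bochner_Integration.integrable_bound[OF integrable_std_normal_id])
       (auto simp: indicator_def)
  have int2: "integrable std_normal (\<lambda>z. indicator {z. g < gam z} z * (exp (- c (gam z)) * z))"
    by (rule Bochner_Integration.integrable_bound[OF integrable_std_normal_id])
       (auto simp: indicator_def abs_mult intro!: mult_left_le_one_le less_imp_le[OF c_pos])
  have "Hermite_coeff M Z1 Z2 \<alpha> 1 0 x \<beta> =
      (\<integral>z. indicator {z. gam z \<le> g} z * z + indicator {z. g < gam z} z * (exp (- c (gam z)) * z) \<partial>std_normal)"
    unfolding Hermite_coeff_1_0_iterated inner by (simp add: algebra_simps)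
  also have "\<dots> = (\<integral>z. indicator {z. gam z \<le> g} z * z \<partial>std_normal) +
      (\<integral>z. indicator {z. g < gam z} z * (exp (- c (gam z)) * z) \<partial>std_normal)"
    by (rule Bochner_Integration.integral_add[OF int1 int2])
  also have "(\<integral>z. indicator {z. gam z \<le> g} z * z \<partial>std_normal) = - phi_Phi_inv (1 / pi * (g + pi / 2))"
    unfolding gam_le_iff by (rule std_normal_lower_mean)
  also have "(\<integral>z. indicator {z. g < gam z} z * (exp (- c (gam z)) * z) \<partial>std_normal) =
      (\<integral>z. indicator {z. g < gam z} z * (exp (- c (gam z)) * Phi_inv (1 / pi * (gam z + pi / 2))) \<partial>std_normal)"
    by (simp only: Phi_eq_gam[symmetric] Phi_inv_Phi)
  also have "\<dots> = 1 / pi * (LBINT \<gamma>=ereal g..ereal (pi / 2). exp (- c \<gamma>) * Phi_inv (1 / pi * (\<gamma> + pi / 2)))"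
    by (rule expectation_above_angle[OF _ g]) measurable
  finally show ?thesis by (simp add: J10_formula_def g_def c_def)
qed

text \<open>This form, before the change of variables, is the convenient one for strict positivity, since it
  is an expectation under a probability measure.\<close>

lemma Hermite_coeff_0_1_above_angle:
  assumes \<alpha>: "0 < \<alpha>" "\<alpha> < 1" and \<beta>: "-1 \<le> \<beta>" "\<beta> \<le> 1" and x: "0 < x"
  shows "Hermite_coeff M Z1 Z2 \<alpha> 0 1 x \<beta> =
    (\<integral>z. indicator {z. gamma0 \<alpha> \<beta> < gam z} z *
      phi_Phi_inv (1 - exp (- (x powr (\<alpha> / (\<alpha> - 1)) * a_fun \<alpha> \<beta> (gam z)))) \<partial>std_normal)"
  unfolding Hermite_coeff_0_1_iterated
proof (rule Bochner_Integration.integral_cong[OF refl])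
  fix z1
  let ?p = "1 - exp (- (x powr (\<alpha> / (\<alpha> - 1)) * a_fun \<alpha> \<beta> (gam z1)))"
  show "(\<integral>z2. indicator {z2. G0 \<alpha> \<beta> z1 z2 \<le> x} z2 * z2 \<partial>std_normal) =
      indicator {z. gamma0 \<alpha> \<beta> < gam z} z1 * phi_Phi_inv ?p"
  proof (cases "gam z1 \<le> gamma0 \<alpha> \<beta>")
    case True
    then show ?thesis by (simp add: G0_le_pos_iff[OF \<alpha> \<beta> x] expectation_std_normal)
  next
    case False
    then have "{z2. G0 \<alpha> \<beta> z1 z2 \<le> x} = {z2. ?p \<le> Phi z2}"
      by (auto simp: G0_le_pos_iff[OF \<alpha> \<beta> x])
    then have "(\<integral>z2. indicator {z2. G0 \<alpha> \<beta> z1 z2 \<le> x} z2 * z2 \<partial>std_normal) = phi_Phi_inv ?p"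
      by (simp only: std_normal_upper_mean)
    then show ?thesis using False by simp
  qed
qed

lemma Hermite_coeff_0_1_pos:
  assumes \<alpha>: "0 < \<alpha>" "\<alpha> < 1" and \<beta>: "-1 \<le> \<beta>" "\<beta> \<le> 1" and x: "0 < x"
  shows "Hermite_coeff M Z1 Z2 \<alpha> 0 1 x \<beta> = J01_formula \<alpha> x \<beta>"
  unfolding Hermite_coeff_0_1_above_angle[OF assms] J01_formula_def
  by (rule expectation_above_angle[OF _ gamma0_bounds[OF \<alpha> \<beta>]]) measurable

text \<open>For \<open>\<beta> > -1\<close> the angle exceeds \<open>\<gamma>\<^sub>0\<close> with positive probability, and there the integrand is
  positive.\<close>

lemma Hermite_coeff_0_1_nonzero:
  assumes \<alpha>: "0 < \<alpha>" "\<alpha> < 1" and \<beta>: "-1 < \<beta>" "\<beta> \<le> 1" and x: "0 < x"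
  shows "Hermite_coeff M Z1 Z2 \<alpha> 0 1 x \<beta> \<noteq> 0"
proof -
  note \<beta>' = less_imp_le[OF \<beta>(1)] \<beta>(2)
  define h where "h z = indicator {z. gamma0 \<alpha> \<beta> < gam z} z *
    phi_Phi_inv (1 - exp (- (x powr (\<alpha> / (\<alpha> - 1)) * a_fun \<alpha> \<beta> (gam z))))" for z
  have [measurable]: "h \<in> borel_measurable borel"
    unfolding h_def[abs_def] by measurable
  have h_bounds: "0 \<le> h z" "h z \<le> 1 / sqrt (2 * pi)" for z
    by (auto simp: h_def indicator_def phi_Phi_inv_def std_normal_density_def divide_right_mono)
  have h_pos: "0 < h z" if "gamma0 \<alpha> \<beta> < gam z" for z
    using that a_fun_pos[OF \<alpha> \<beta>' that gam_bounds(2)] x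
    by (auto simp: h_def intro!: phi_Phi_inv_pos)
  have int: "integrable std_normal h"
    by (rule std_normal.integrable_const_bound[of _ "1 / sqrt (2 * pi)"]) (use h_bounds in auto)
  have "gamma0 \<alpha> \<beta> < pi / 2"
    using mult_strict_right_mono[OF \<beta>(1), of "pi / 2"] by (simp add: gamma0_eq[OF \<alpha>])
  then have "1 / pi * (gamma0 \<alpha> \<beta> + pi / 2) < 1" by (simp add: field_simps)
  moreover have "0 \<le> 1 / pi * (gamma0 \<alpha> \<beta> + pi / 2)"
    using gamma0_bounds(1)[OF \<alpha> \<beta>'] by simp
  ultimately have below: "measure std_normal {z. gam z \<le> gamma0 \<alpha> \<beta>} < 1"
    unfolding gam_le_iff by (subst prob_Phi_le) auto
  have "(\<integral>z. h z \<partial>std_normal) \<noteq> 0"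
  proof
    assume "(\<integral>z. h z \<partial>std_normal) = 0"
    then have "AE z in std_normal. h z = 0"
      using integral_nonneg_eq_0_iff_AE[OF int] h_bounds(1) by simp
    then have "AE z in std_normal. z \<in> {z. gam z \<le> gamma0 \<alpha> \<beta>}"
      by eventually_elim (use h_pos in \<open>force simp: not_less[symmetric]\<close>)
    then have "measure std_normal {z. gam z \<le> gamma0 \<alpha> \<beta>} = 1"
      by (subst std_normal.prob_eq_1) auto
    then show False using below by simp
  qed
  then show ?thesis
    unfolding Hermite_coeff_0_1_above_angle[OF \<alpha> \<beta>' x] h_def .
qed

lemma Hermite_coeff_1_0_zero:
  assumes \<alpha>: "0 < \<alpha>" "\<alpha> < 1" and \<beta>: "-1 \<le> \<beta>" "\<beta> \<le> 1"
  shows "Hermite_coeff M Z1 Z2 \<alpha> 1 0 0 \<beta> = - phi_Phi_inv (1 / pi * (gamma0 \<alpha> \<beta> + pi / 2))"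
proof -
  have "measure std_normal {z2. G0 \<alpha> \<beta> z1 z2 \<le> 0} = indicator {z. gam z \<le> gamma0 \<alpha> \<beta>} z1" for z1
    using std_normal.prob_space by (simp add: G0_le_zero_iff[OF assms])
  then have "Hermite_coeff M Z1 Z2 \<alpha> 1 0 0 \<beta> =
      (\<integral>z. indicator {z. gam z \<le> gamma0 \<alpha> \<beta>} z * z \<partial>std_normal)"
    unfolding Hermite_coeff_1_0_iterated by (simp add: mult.commute)
  also have "\<dots> = - phi_Phi_inv (1 / pi * (gamma0 \<alpha> \<beta> + pi / 2))"
    unfolding gam_le_iff by (rule std_normal_lower_mean)
  finally show ?thesis .
qed

lemma Hermite_coeff_0_1_zero:
  assumes \<alpha>: "0 < \<alpha>" "\<alpha> < 1" and \<beta>: "-1 \<le> \<beta>" "\<beta> \<le> 1"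
  shows "Hermite_coeff M Z1 Z2 \<alpha> 0 1 0 \<beta> = 0"
proof -
  have "(\<integral>z2. indicator {z2. G0 \<alpha> \<beta> z1 z2 \<le> 0} z2 * z2 \<partial>std_normal) = 0" for z1
    by (cases "gam z1 \<le> gamma0 \<alpha> \<beta>") (simp_all add: G0_le_zero_iff[OF assms] expectation_std_normal)
  then show ?thesis unfolding Hermite_coeff_0_1_iterated by simp
qed

lemma Hermite_rank_eq_1I:
  assumes "Hermite_coeff M Z1 Z2 \<alpha> 1 0 x \<beta> \<noteq> 0 \<or> Hermite_coeff M Z1 Z2 \<alpha> 0 1 x \<beta> \<noteq> 0"
  shows "Hermite_rank M Z1 Z2 \<alpha> x \<beta> = 1"
  unfolding Hermite_rank_def
proof (rule antisym)
  show "Inf {enat (m1 + m2) | m1 m2. m1 + m2 \<ge> 1 \<and> Hermite_coeff M Z1 Z2 \<alpha> m1 m2 x \<beta> \<noteq> 0} \<le> 1"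
    using assms by (intro Inf_lower) (force simp: one_enat_def)
  show "1 \<le> Inf {enat (m1 + m2) | m1 m2. m1 + m2 \<ge> 1 \<and> Hermite_coeff M Z1 Z2 \<alpha> m1 m2 x \<beta> \<noteq> 0}"
    by (intro Inf_greatest) (auto simp: one_enat_def)
qed

text \<open>The witness is \<open>J\<^sub>0\<^sub>,\<^sub>1\<close> for \<open>x \<noteq> 0\<close>, but it vanishes at \<open>x = 0\<close>, where \<open>J\<^sub>1\<^sub>,\<^sub>0\<close> takes over.\<close>

lemma Hermite_rank_eq_1:
  assumes \<alpha>: "0 < \<alpha>" "\<alpha> < 1" and \<beta>: "-1 \<le> \<beta>" "\<beta> \<le> 1"
    and nondegenerate: "\<not> (\<beta> = 1 \<and> x \<le> 0)" "\<not> (\<beta> = -1 \<and> 0 \<le> x)"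
  shows "Hermite_rank M Z1 Z2 \<alpha> x \<beta> = 1"
proof (rule Hermite_rank_eq_1I)
  consider "0 < x" | "x = 0" | "x < 0" by linarith
  then show "Hermite_coeff M Z1 Z2 \<alpha> 1 0 x \<beta> \<noteq> 0 \<or> Hermite_coeff M Z1 Z2 \<alpha> 0 1 x \<beta> \<noteq> 0"
  proof cases
    case 1
    then have "-1 < \<beta>" using \<beta> nondegenerate by auto
    then show ?thesis using Hermite_coeff_0_1_nonzero[OF \<alpha> _ \<beta>(2) 1] by blast
  next
    case 2
    then have "-1 < \<beta>" "\<beta> < 1" using \<beta> nondegenerate by auto
    have level: "1 / pi * (gamma0 \<alpha> \<beta> + pi / 2) = (1 - \<beta>) / 2"
      unfolding gamma0_eq[OF \<alpha>] by (simp add: field_simps)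
    have "0 < 1 / pi * (gamma0 \<alpha> \<beta> + pi / 2)" "1 / pi * (gamma0 \<alpha> \<beta> + pi / 2) < 1"
      unfolding level using \<open>-1 < \<beta>\<close> \<open>\<beta> < 1\<close> by simp_all
    then show ?thesis
      using phi_Phi_inv_pos Hermite_coeff_1_0_zero[OF \<alpha> \<beta>] 2 by fastforce
  next
    case 3
    then have "\<beta> < 1" using \<beta> nondegenerate by auto
    then have "Hermite_coeff M Z1 Z2 \<alpha> 0 1 (- x) (- \<beta>) \<noteq> 0"
      using 3 \<beta> by (intro Hermite_coeff_0_1_nonzero[OF \<alpha>]) auto
    then show ?thesis
      using Hermite_coeff_0_1_reflect[OF \<alpha> \<beta>, of x] 3 by simp
  qed
qed

end

theorem theorem1:
  fixes M :: "'w measure" and Z1 Z2 :: "'w \<Rightarrow> real" and \<alpha> \<beta>\<^sub>2 :: real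
  assumes "prob_space M"
    and "distributed M lborel Z1 std_normal_density"
    and "distributed M lborel Z2 std_normal_density"
    and "prob_space.indep_var M borel Z1 borel Z2"
    and "0 < \<alpha>" and "\<alpha> < 1"
    and "-1 \<le> \<beta>\<^sub>2" and "\<beta>\<^sub>2 \<le> 1"
  shows
    "(\<forall>x. \<not> (\<beta>\<^sub>2 = 1 \<and> x \<le> 0) \<and> \<not> (\<beta>\<^sub>2 = -1 \<and> 0 \<le> x) \<longrightarrow>
        Hermite_rank M Z1 Z2 \<alpha> x \<beta>\<^sub>2 = 1)
   \<and> (\<forall>x>0.
        Hermite_coeff M Z1 Z2 \<alpha> 1 0 x \<beta>\<^sub>2 = J10_formula \<alpha> x \<beta>\<^sub>2 \<and>
        Hermite_coeff M Z1 Z2 \<alpha> 0 1 x \<beta>\<^sub>2 = J01_formula \<alpha> x \<beta>\<^sub>2)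
   \<and> (Hermite_coeff M Z1 Z2 \<alpha> 1 0 0 \<beta>\<^sub>2 = - phi_Phi_inv (1 / pi * (gamma0 \<alpha> \<beta>\<^sub>2 + pi / 2)) \<and>
      Hermite_coeff M Z1 Z2 \<alpha> 0 1 0 \<beta>\<^sub>2 = 0)
   \<and> (\<forall>x<0.
        Hermite_coeff M Z1 Z2 \<alpha> 1 0 x \<beta>\<^sub>2 = Hermite_coeff M Z1 Z2 \<alpha> 1 0 (- x) (- \<beta>\<^sub>2) \<and>
        Hermite_coeff M Z1 Z2 \<alpha> 1 0 (- x) (- \<beta>\<^sub>2) = J10_formula \<alpha> (- x) (- \<beta>\<^sub>2) \<and>
        Hermite_coeff M Z1 Z2 \<alpha> 0 1 x \<beta>\<^sub>2 = - Hermite_coeff M Z1 Z2 \<alpha> 0 1 (- x) (- \<beta>\<^sub>2) \<and>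
        Hermite_coeff M Z1 Z2 \<alpha> 0 1 (- x) (- \<beta>\<^sub>2) = J01_formula \<alpha> (- x) (- \<beta>\<^sub>2))"
proof -
  interpret independent_std_normals M Z1 Z2
    using assms(1-4) by (intro independent_std_normals.intro independent_std_normals_axioms.intro)
  note params = assms(5-8)
  have minus: "-1 \<le> - \<beta>\<^sub>2" "- \<beta>\<^sub>2 \<le> 1" using params by auto
  show ?thesis
  proof (intro conjI allI impI)
    fix x :: real assume x: "x < 0"
    then have x': "x \<noteq> 0" "0 < - x" by auto
    show "Hermite_coeff M Z1 Z2 \<alpha> 1 0 x \<beta>\<^sub>2 = Hermite_coeff M Z1 Z2 \<alpha> 1 0 (- x) (- \<beta>\<^sub>2)"
      by (rule Hermite_coeff_1_0_reflect[OF params x'(1)])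
    show "Hermite_coeff M Z1 Z2 \<alpha> 1 0 (- x) (- \<beta>\<^sub>2) = J10_formula \<alpha> (- x) (- \<beta>\<^sub>2)"
      by (rule Hermite_coeff_1_0_pos[OF params(1,2) minus x'(2)])
    show "Hermite_coeff M Z1 Z2 \<alpha> 0 1 x \<beta>\<^sub>2 = - Hermite_coeff M Z1 Z2 \<alpha> 0 1 (- x) (- \<beta>\<^sub>2)"
      by (rule Hermite_coeff_0_1_reflect[OF params x'(1)])
    show "Hermite_coeff M Z1 Z2 \<alpha> 0 1 (- x) (- \<beta>\<^sub>2) = J01_formula \<alpha> (- x) (- \<beta>\<^sub>2)"
      by (rule Hermite_coeff_0_1_pos[OF params(1,2) minus x'(2)])
  qed (use Hermite_rank_eq_1[OF params] Hermite_coeff_1_0_pos[OF params]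
      Hermite_coeff_0_1_pos[OF params] Hermite_coeff_1_0_zero[OF params]
      Hermite_coeff_0_1_zero[OF params] in blast)+
qed

end
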